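(* Let $G$ be a connected graph such that $\overline{G}$ is connected. Then $\mathrm{c}_m(G\overline{G})=\max\{\omega(G),\alpha(G)\}$.
   Context: All graphs are finite, simple and undirected. The complementary prism $G\overline{G}$ of a graph $G$ is obtained from the disjoint union of $G$ and its complement $\overline{G}$ by adding the edges of the perfect matching joining each vertex $u$ of $G$ to its copy $\overline{u}$ in $\overline{G}$. A path is monophonic if it is an induced (chordless) path. A set $S$ of vertices of a graph $H$ is monophonic convex if $S$ contains every vertex of every monophonic path between two vertices of $S$. The monophonic convexity number $\mathrm{c}_m(H)$ is the maximum cardinality of a proper (i.e. $\neq V(H)$) monophonic convex set of $H$. $\omega(G)$ is the clique number and $\alpha(G)$ the independence number of $G$. *)

theory Defs
  imports "Graph_Theory.Digraph_Component" "Graph_Theory.Vertex_Walk"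
begin

text \<open>
  A finite simple undirected graph is a symmetric loop-free finite digraph whose arcs are pairs
  of vertices, that is, a \<^typ>\<open>'a pair_pre_digraph\<close> satisfying \<^locale>\<open>pair_graph\<close>:
  the edge \<open>{u, v}\<close> is the pair of arcs \<open>(u, v)\<close> and \<open>(v, u)\<close>. The definitions below are meant for
  such graphs only.
\<close>

definition graph_complement :: "'a pair_pre_digraph \<Rightarrow> 'a pair_pre_digraph" where
  "graph_complement G =
     \<lparr> pverts = pverts G,
       parcs = {(u, v). u \<in> pverts G \<and> v \<in> pverts G \<and> u \<noteq> v \<and> (u, v) \<notin> parcs G} \<rparr>"

text \<open>\<open>Inl u\<close> is the vertex \<open>u\<close> of \<open>G\<close>, \<open>Inr u\<close> its copy in the complement of \<open>G\<close>.\<close>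

definition complementary_prism :: "'a pair_pre_digraph \<Rightarrow> ('a + 'a) pair_pre_digraph" where
  "complementary_prism G =
     \<lparr> pverts = pverts G <+> pverts G,
       parcs = {(Inl u, Inl v) | u v. (u, v) \<in> parcs G}
             \<union> {(Inr u, Inr v) | u v. (u, v) \<in> parcs (graph_complement G)}
             \<union> {(Inl u, Inr u) | u. u \<in> pverts G}
             \<union> {(Inr u, Inl u) | u. u \<in> pverts G} \<rparr>"

text \<open>
  Paths are given by their vertex sequences. Adjacency of \<open>p ! i\<close> and \<open>p ! j\<close> only needs to be
  tested in one direction, since the arc relation of an undirected graph is symmetric.
\<close>

definition monophonic_path :: "'a pair_pre_digraph \<Rightarrow> 'a list \<Rightarrow> bool" where
  "monophonic_path H p \<longleftrightarrow> vpath p (with_proj H) \<and>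
     (\<forall>i j. i < j \<and> j < length p \<and> (p ! i, p ! j) \<in> parcs H \<longrightarrow> j = Suc i)"

definition monophonic_convex :: "'a pair_pre_digraph \<Rightarrow> 'a set \<Rightarrow> bool" where
  "monophonic_convex H S \<longleftrightarrow> S \<subseteq> pverts H \<and>
     (\<forall>p. monophonic_path H p \<and> hd p \<in> S \<and> last p \<in> S \<longrightarrow> set p \<subseteq> S)"

text \<open>
  The three maxima range over finite sets when the graph is finite. For the clique and independence
  numbers the set of cardinalities always contains \<open>0\<close>; for the convexity number it does as soon
  as the graph has a vertex, because the empty set is then a proper convex set.
\<close>

definition monophonic_convexity_number :: "'a pair_pre_digraph \<Rightarrow> nat" where
  "monophonic_convexity_number H = Max {card S | S. monophonic_convex H S \<and> S \<noteq> pverts H}"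

definition clique :: "'a pair_pre_digraph \<Rightarrow> 'a set \<Rightarrow> bool" where
  "clique G S \<longleftrightarrow> S \<subseteq> pverts G \<and> (\<forall>u\<in>S. \<forall>v\<in>S. u \<noteq> v \<longrightarrow> (u, v) \<in> parcs G)"

definition independent :: "'a pair_pre_digraph \<Rightarrow> 'a set \<Rightarrow> bool" where
  "independent G S \<longleftrightarrow> S \<subseteq> pverts G \<and> (\<forall>u\<in>S. \<forall>v\<in>S. (u, v) \<notin> parcs G)"

definition clique_number :: "'a pair_pre_digraph \<Rightarrow> nat" where
  "clique_number G = Max {card S | S. clique G S}"

definition independence_number :: "'a pair_pre_digraph \<Rightarrow> nat" where
  "independence_number G = Max {card S | S. independent G S}"

lemma pair_graphI:
  assumes "finite (pverts H)" "parcs H \<subseteq> pverts H \<times> pverts H" "sym (parcs H)"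
    and "\<And>u. (u, u) \<notin> parcs H"
  shows "pair_graph H"
proof -
  have "finite (parcs H)"
    using assms(1,2) by (meson finite_SigmaI finite_subset)
  then show ?thesis
    using assms by unfold_locales (auto simp: symmetric_def)
qed

lemma pair_graph_sym_arcs:
  assumes "pair_graph G" "(u, v) \<in> parcs G"
  shows "(v, u) \<in> parcs G"
proof -
  interpret pair_graph G by fact
  show ?thesis
    using pair_sym_arcs assms(2) by (auto simp: symmetric_def sym_def)
qed

lemma pair_graph_graph_complement:
  assumes "pair_graph G"
  shows "pair_graph (graph_complement G)"
proof -
  interpret pair_graph G by fact
  show ?thesis
    by (rule pair_graphI)
      (use assms in \<open>auto simp: graph_complement_def sym_def pair_finite_verts dest: pair_graph_sym_arcs\<close>)
qed

lemma pair_graph_complementary_prism: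
  assumes "pair_graph G"
  shows "pair_graph (complementary_prism G)"
proof -
  interpret pair_graph G by fact
  show ?thesis
    by (rule pair_graphI)
      (use assms in \<open>auto simp: complementary_prism_def graph_complement_def sym_def
        pair_finite_verts dest: pair_graph_sym_arcs in_arcsD1 in_arcsD2 pair_no_loops\<close>)
qed

end

theory Submission
  imports Defs
begin

text \<open>
  A clique is convex because its only monophonic paths are vertices and edges. Conversely, let \<open>S\<close>
  be convex, meeting \<open>G\<close> in \<open>A\<close> and the complement in (the copy of) \<open>B\<close>. If \<open>A\<close> contains two
  non-adjacent vertices \<open>u\<close>, \<open>v\<close>, the induced path through \<open>u\<close> and \<open>v\<close> and their copies shows that
  \<open>B\<close> is non-empty; so if one of \<open>A\<close>, \<open>B\<close> is empty, \<open>S\<close> is a clique of \<open>G\<close> or of its complement.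
  If \<open>u \<in> A\<close> and \<open>w \<in> B\<close> are distinct, an induced path from \<open>u\<close> to \<open>w\<close> in \<open>G\<close> or in the
  complement (whichever lacks the edge) yields \<open>u, w \<in> A \<inter> B\<close>. Hence either \<open>A = B\<close> is a singleton,
  or \<open>A = B\<close> has at least two elements. In the latter case \<open>A\<close> is a module of \<open>G\<close>: a vertex \<open>x\<close>
  outside \<open>A\<close> adjacent to \<open>u \<in> A\<close> but not to \<open>v \<in> A\<close> would lie on an induced path from \<open>u\<close> through
  \<open>x\<close> and its copy to the copy of \<open>v\<close>. An outside vertex completely joined to \<open>A\<close> forces \<open>A\<close> to be
  a clique, one completely non-adjacent to \<open>A\<close> forces \<open>A\<close> to be independent; both cannot occur, and
  as \<open>G\<close> and its complement are connected, there is no outside vertex at all.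
\<close>

section \<open>Monophonic paths\<close>

lemma monophonic_path_Nil [simp]: "\<not> monophonic_path H []"
  by (auto simp: monophonic_path_def vpath_def vwalk_def)

lemma monophonic_path_single [simp]: "monophonic_path H [x] \<longleftrightarrow> x \<in> pverts H"
  by (auto simp: monophonic_path_def vpath_def vwalk_def)

text \<open>Turns the index condition into a recursion on the list, so that \<open>simp\<close> can
  check explicit short paths.\<close>

lemma monophonic_path_Cons_Cons [simp]:
  "monophonic_path H (x # y # p) \<longleftrightarrow>
     x \<in> pverts H \<and> x \<noteq> y \<and> x \<notin> set p \<and> (x, y) \<in> parcs H \<and> (\<forall>z\<in>set p. (x, z) \<notin> parcs H) \<and>
     monophonic_path H (y # p)" (is "?L \<longleftrightarrow> ?R")
proof -
  let ?c = "\<lambda>q. \<forall>i j. i < j \<and> j < length q \<and> (q ! i, q ! j) \<in> parcs H \<longrightarrow> j = Suc i"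
  have "?c (x # y # p) \<longleftrightarrow> (\<forall>z\<in>set p. (x, z) \<notin> parcs H) \<and> ?c (y # p)"
  proof (intro iffI conjI)
    assume c: "?c (x # y # p)"
    show "\<forall>z\<in>set p. (x, z) \<notin> parcs H"
    proof
      fix z assume "z \<in> set p"
      then obtain k where "k < length p" "p ! k = z" by (auto simp: in_set_conv_nth)
      then show "(x, z) \<notin> parcs H"
        using c[rule_format, of 0 "Suc (Suc k)"] by auto
    qed
    show "?c (y # p)"
    proof (intro allI impI)
      fix i j assume "i < j \<and> j < length (y # p) \<and> ((y # p) ! i, (y # p) ! j) \<in> parcs H"
      then show "j = Suc i"
        using c[rule_format, of "Suc i" "Suc j"] by auto
    qed
  next
    assume *: "(\<forall>z\<in>set p. (x, z) \<notin> parcs H) \<and> ?c (y # p)"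
    show "?c (x # y # p)"
    proof (intro allI impI, elim conjE)
      fix i j
      assume a: "i < j" "j < length (x # y # p)" "((x # y # p) ! i, (x # y # p) ! j) \<in> parcs H"
      then obtain j' where j: "j = Suc j'" by (cases j) auto
      show "j = Suc i"
      proof (cases i)
        case 0
        show ?thesis
        proof (cases j')
          case (Suc k)
          then have "p ! k \<in> set p" "(x, p ! k) \<in> parcs H" using a j 0 by simp_all
          then show ?thesis using conjunct1[OF *] by blast
        qed (simp add: 0 j)
      next
        case (Suc i')
        then have "i' < j' \<and> j' < length (y # p) \<and> ((y # p) ! i', (y # p) ! j') \<in> parcs H"
          using a j by simp
        then have "j' = Suc i'" using conjunct2[OF *] by blast
        then show ?thesis by (simp add: j Suc)
      qed
    qed
  qed
  then show ?thesis
    by (auto simp: monophonic_path_def vpath_def vwalk_def)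
qed

lemma monophonic_path_appendD:
  "monophonic_path H (p @ q) \<Longrightarrow> q \<noteq> [] \<Longrightarrow> monophonic_path H q"
proof (induction p)
  case (Cons x p)
  then show ?case by (cases "p @ q") auto
qed simp

lemma monophonic_path_subset: "monophonic_path H p \<Longrightarrow> set p \<subseteq> pverts H"
  by (auto simp: monophonic_path_def vpath_def vwalk_def)

text \<open>Needed to carry paths of the complement into the prism, where each side is an induced
  subgraph.\<close>

lemma monophonic_path_map:
  assumes "inj_on f (pverts G)" and "f ` pverts G \<subseteq> pverts H"
    and "\<And>u v. u \<in> pverts G \<Longrightarrow> v \<in> pverts G \<Longrightarrow> (f u, f v) \<in> parcs H \<longleftrightarrow> (u, v) \<in> parcs G"
  shows "monophonic_path G p \<Longrightarrow> monophonic_path H (map f p)"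
proof (induction p rule: induct_list012)
  case (3 x y p)
  then have "set (x # y # p) \<subseteq> pverts G" using monophonic_path_subset by blast
  then have V: "x \<in> pverts G" "y \<in> pverts G" "set p \<subseteq> pverts G" by auto
  then have "f x \<notin> f ` set p \<longleftrightarrow> x \<notin> set p" "f x \<noteq> f y \<longleftrightarrow> x \<noteq> y"
    using inj_on_image_mem_iff[OF assms(1)] inj_on_eq_iff[OF assms(1)] by blast+
  moreover have "\<forall>z\<in>set p. (f x, f z) \<in> parcs H \<longleftrightarrow> (x, z) \<in> parcs G"
    using V assms(3) by blast
  moreover have "f x \<in> pverts H" using V assms(2) by blast
  ultimately show ?case using 3 V assms(3)[of x y] by simp
qed (use assms in auto)

text \<open>If \<open>u\<close> lies on \<open>p\<close>, the suffix from \<open>u\<close> on works;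
  otherwise jumping from \<open>u\<close> to its last neighbour on \<open>p\<close> leaves no chord
  at \<open>u\<close>.\<close>

lemma monophonic_path_Cons_shortcut:
  assumes p: "monophonic_path H p" and u: "u \<in> pverts H" "(u, hd p) \<in> parcs H"
  shows "\<exists>q. monophonic_path H q \<and> hd q = u \<and> last q = last p"
proof (cases "u \<in> set p")
  case True
  then obtain ys zs where "p = ys @ u # zs" by (auto simp: in_set_conv_decomp)
  with p show ?thesis
    using monophonic_path_appendD[of H ys "u # zs"] by (intro exI[of _ "u # zs"]) auto
next
  case False
  from p have "p \<noteq> []" by auto
  with u(2) have "\<exists>z\<in>set p. (u, z) \<in> parcs H" by (intro bexI[of _ "hd p"]) auto
  then obtain ys z zs where
    *: "p = ys @ z # zs" "(u, z) \<in> parcs H" "\<forall>x\<in>set zs. (u, x) \<notin> parcs H"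
    using split_list_last_prop[of p "\<lambda>z. (u, z) \<in> parcs H"] by blast
  with p False u(1) show ?thesis
    using monophonic_path_appendD[of H ys "z # zs"] by (intro exI[of _ "u # z # zs"]) auto
qed

lemma connected_reachable:
  assumes "pair_graph G" "Digraph_Component.connected (with_proj G)" "u \<in> pverts G" "v \<in> pverts G"
  shows "u \<rightarrow>\<^sup>*\<^bsub>with_proj G\<^esub> v"
proof -
  interpret pair_graph G by fact
  show ?thesis
    using symmetric_connected_imp_strongly_connected assms by (auto simp: sym_arcs)
qed

text \<open>Induction along a walk, removing chords each time a vertex is put in front.\<close>

lemma connected_monophonic_path:
  assumes G: "pair_graph G" and "Digraph_Component.connected (with_proj G)"
    and "u \<in> pverts G" "v \<in> pverts G"
  obtains p where "monophonic_path G p" "hd p = u" "last p = v"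
proof -
  interpret pair_graph G by fact
  from connected_reachable[OF assms]
  have "\<exists>p. monophonic_path G p \<and> hd p = u \<and> last p = v"
  proof (induction rule: converse_reachable_induct)
    case base
    then show ?case by (intro exI[of _ "[v]"]) auto
  next
    case (step x y)
    then show ?case
      using monophonic_path_Cons_shortcut[of G _ x] in_arcsD1 by fastforce
  qed
  then show thesis using that by blast
qed

lemma connected_arc_leaving:
  assumes G: "pair_graph G" and "Digraph_Component.connected (with_proj G)"
    and "u \<in> C" "u \<in> pverts G" and "y \<in> pverts G" "y \<notin> C"
  obtains v x where "v \<in> C" "x \<notin> C" "(v, x) \<in> parcs G"
proof -
  interpret pair_graph G by fact
  from connected_reachable[OF assms(1,2,4,5)] assms(6)
  have "\<exists>v x. v \<in> C \<and> x \<notin> C \<and> (v, x) \<in> parcs G"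
    using assms(3)
    by (induction rule: converse_reachable_induct) auto
  then show thesis using that by blast
qed

section \<open>Convexity of cliques\<close>

lemma monophonic_path_hd_last_adjacent:
  assumes "monophonic_path H p" "(hd p, last p) \<in> parcs H" "length p \<noteq> 1"
  shows "set p = {hd p, last p}"
proof -
  have c: "\<And>i j. i < j \<Longrightarrow> j < length p \<Longrightarrow> (p ! i, p ! j) \<in> parcs H \<Longrightarrow> j = Suc i"
    and "p \<noteq> []"
    using assms(1) by (auto simp: monophonic_path_def vpath_def vwalk_def)
  \<comment> \<open>The arc between the ends, at indices \<open>0\<close> and
    \<open>length p - 1\<close>, would be a chord unless these are consecutive.\<close>
  with assms(2,3) have "length p - 1 = Suc 0"
    by (intro c) (auto simp: hd_conv_nth last_conv_nth neq_Nil_conv)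
  then obtain x y where "p = [x, y]"
    by (cases p rule: remdups_adj.cases) auto
  then show ?thesis by auto
qed

lemma monophonic_convexD:
  assumes "monophonic_convex H S" "monophonic_path H p" "hd p \<in> S" "last p \<in> S" "x \<in> set p"
  shows "x \<in> S"
  using assms unfolding monophonic_convex_def by blast

lemma clique_monophonic_convex:
  assumes "clique H S"
  shows "monophonic_convex H S"
  unfolding monophonic_convex_def
proof (intro conjI allI impI)
  show "S \<subseteq> pverts H" using assms by (simp add: clique_def)
  fix p assume p: "monophonic_path H p \<and> hd p \<in> S \<and> last p \<in> S"
  show "set p \<subseteq> S"
  proof (cases "hd p = last p")
    case True
    moreover from p have "distinct p" "p \<noteq> []"
      by (auto simp: monophonic_path_def vpath_def vwalk_def)
    ultimately obtain x where "p = [x]"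
      by (cases p) (auto split: if_splits)
    with p show ?thesis by auto
  next
    case False
    with p assms have "(hd p, last p) \<in> parcs H" by (simp add: clique_def)
    moreover from False have "length p \<noteq> 1" by (auto simp: length_Suc_conv)
    ultimately show ?thesis using p monophonic_path_hd_last_adjacent[of H p] by auto
  qed
qed

section \<open>Convex sets of the complementary prism\<close>

text \<open>
  Exchanging \<open>G\<close> and \<open>K\<close> as well as \<open>f\<close> and \<open>g\<close> preserves the assumptions, so that each statement
  about the \<open>G\<close>-side is also available for the complement.
\<close>

locale prism =
  fixes G K :: "'a pair_pre_digraph" and H :: "'b pair_pre_digraph" and f g :: "'a \<Rightarrow> 'b"
  assumes graph_G: "pair_graph G" and graph_K: "pair_graph K"
    and connected_G: "Digraph_Component.connected (with_proj G)"
    and connected_K: "Digraph_Component.connected (with_proj K)"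
    and verts_K: "pverts K = pverts G"
    and arcs_K: "u \<in> pverts G \<Longrightarrow> v \<in> pverts G \<Longrightarrow> u \<noteq> v \<Longrightarrow> (u, v) \<in> parcs K \<longleftrightarrow> (u, v) \<notin> parcs G"
    and verts_H: "pverts H = f ` pverts G \<union> g ` pverts G"
    and inj_f: "inj f" and inj_g: "inj g" and f_neq_g: "f u \<noteq> g v"
    and arcs_ff: "u \<in> pverts G \<Longrightarrow> v \<in> pverts G \<Longrightarrow> (f u, f v) \<in> parcs H \<longleftrightarrow> (u, v) \<in> parcs G"
    and arcs_gg: "u \<in> pverts G \<Longrightarrow> v \<in> pverts G \<Longrightarrow> (g u, g v) \<in> parcs H \<longleftrightarrow> (u, v) \<in> parcs K"
    and arcs_fg: "u \<in> pverts G \<Longrightarrow> v \<in> pverts G \<Longrightarrow> (f u, g v) \<in> parcs H \<longleftrightarrow> u = v"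
    and arcs_gf: "u \<in> pverts G \<Longrightarrow> v \<in> pverts G \<Longrightarrow> (g u, f v) \<in> parcs H \<longleftrightarrow> u = v"
begin

lemma swap: "prism K G H g f"
proof -
  have "g u \<noteq> f v" for u v using f_neq_g[of v u] by simp
  then show ?thesis
    by (intro prism.intro)
      (auto simp: graph_G graph_K connected_G connected_K verts_K arcs_K verts_H inj_f inj_g
        arcs_ff arcs_gg arcs_fg arcs_gf)
qed

lemmas [simp] = arcs_ff arcs_gg arcs_fg arcs_gf f_neq_g f_neq_g[symmetric]
  inj_eq[OF inj_f] inj_eq[OF inj_g]

lemma G_sym: "(u, v) \<in> parcs G \<Longrightarrow> (v, u) \<in> parcs G"
  using pair_graph_sym_arcs[OF graph_G] .

lemma G_irrefl [simp]: "(u, u) \<notin> parcs G"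
  using pair_graph.axioms(1)[OF graph_G] pair_loopfree_digraph.no_loops'[of G]
  by (auto simp: pair_digraph_def)

lemma non_adjacent_imp_copy:
  assumes S: "monophonic_convex H S" and "f u \<in> S" "f v \<in> S" "u \<in> pverts G" "v \<in> pverts G"
    and "u \<noteq> v" "(u, v) \<notin> parcs G"
  shows "g u \<in> S"
  by (rule monophonic_convexD[OF S, of "[f u, g u, g v, f v]"]) (use assms in \<open>auto simp: arcs_K verts_H\<close>)

text \<open>Two induced paths join \<open>f u\<close> to \<open>g w\<close>: one crosses over at
  \<open>w\<close>, the other at \<open>u\<close> and then follows an induced path of
  \<open>K\<close>.\<close>

lemma adjacent_cross:
  assumes S: "monophonic_convex H S" and "f u \<in> S" "g w \<in> S" and V: "u \<in> pverts G" "w \<in> pverts G"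
    and uw: "(u, w) \<in> parcs G"
  shows "f w \<in> S" "g u \<in> S"
proof -
  have ne: "u \<noteq> w" using uw by auto
  show "f w \<in> S"
    by (rule monophonic_convexD[OF S, of "[f u, f w, g w]"]) (use assms ne in \<open>auto simp: verts_H\<close>)
  obtain p where p: "monophonic_path K p" "hd p = u" "last p = w"
    using connected_monophonic_path[OF graph_K connected_K, of u w] V
    by (auto simp: verts_K)
  then obtain q where q: "p = u # q" by (cases p) auto
  have V': "set p \<subseteq> pverts G" using monophonic_path_subset[OF p(1)] by (simp add: verts_K)
  \<comment> \<open>Hence \<open>g u\<close> is the only neighbour of \<open>f u\<close> on the
    copied path.\<close>
  have "u \<notin> set q" using p(1) q by (cases q) auto
  then have "monophonic_path H (f u # map g p)"
    using monophonic_path_map[OF _ _ _ p(1), of g H] V V' q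
    by (auto simp: inj_on_def verts_K verts_H)
  from monophonic_convexD[OF S this, of "g u"] p q assms
  show "g u \<in> S" by (auto simp: last_map split: if_splits)
qed

lemma cross:
  assumes S: "monophonic_convex H S" and u: "f u \<in> S" "u \<in> pverts G"
    and w: "g w \<in> S" "w \<in> pverts G" and "u \<noteq> w"
  shows "f w \<in> S \<and> g u \<in> S"
proof (cases "(u, w) \<in> parcs G")
  case True
  then show ?thesis using adjacent_cross[OF S u(1) w(1) u(2) w(2)] by blast
next
  case False
  interpret K: prism K G H g f by (rule swap)
  \<comment> \<open>Non-adjacent in \<open>G\<close> means adjacent in \<open>K\<close>, so the
    swapped form of \<open>adjacent_cross\<close> applies with \<open>u\<close> and \<open>w\<close>
    exchanged.\<close>
  have "(w, u) \<in> parcs K" using False K.G_sym arcs_K[OF u(2) w(2) \<open>u \<noteq> w\<close>] by blast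
  then show ?thesis
    using K.adjacent_cross[OF S w(1) u(1)] u(2) w(2) unfolding verts_K by blast
qed

lemma module:
  assumes S: "monophonic_convex H S" and uv: "f u \<in> S" "g v \<in> S"
    and V: "u \<in> pverts G" "v \<in> pverts G" "x \<in> pverts G"
    and ux: "(u, x) \<in> parcs G" and vx: "(v, x) \<notin> parcs G" and ne: "v \<noteq> x" "u \<noteq> v"
  shows "f x \<in> S"
proof -
  have "u \<noteq> x" using ux G_irrefl by blast
  moreover have "(x, v) \<notin> parcs G" using vx G_sym by blast
  ultimately have "monophonic_path H [f u, f x, g x, g v]"
    using V ux ne by (simp add: arcs_K verts_H)
  from monophonic_convexD[OF S this, of "f x"] uv show ?thesis by simp
qed

text \<open>Were \<open>u\<close> and \<open>v\<close> non-adjacent, \<open>f x\<close> would be the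
  middle of an induced path between \<open>f u\<close> and \<open>f v\<close>.\<close>

lemma joined_outside_clique:
  assumes S: "monophonic_convex H S" and x: "x \<in> pverts G" "f x \<notin> S"
    and joined: "\<And>v. v \<in> pverts G \<Longrightarrow> f v \<in> S \<Longrightarrow> (v, x) \<in> parcs G"
    and u: "u \<in> pverts G" "f u \<in> S" and v: "v \<in> pverts G" "f v \<in> S" and ne: "u \<noteq> v"
  shows "(u, v) \<in> parcs G"
proof (rule ccontr)
  assume "(u, v) \<notin> parcs G"
  moreover have "u \<noteq> x" "x \<noteq> v" using x u v by blast+
  moreover note joined[OF u] G_sym[OF joined[OF v]]
  ultimately have "monophonic_path H [f u, f x, f v]"
    using x u v ne by (simp add: verts_H)
  from monophonic_convexD[OF S this, of "f x"] u v x show False by simp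
qed

text \<open>By \<open>module\<close>, one neighbour of \<open>x\<close> in the trace of
  \<open>S\<close> makes \<open>x\<close> adjacent to the whole trace, so
  \<open>joined_outside_clique\<close> applies.\<close>

lemma outside_adjacent_imp_clique:
  assumes S: "monophonic_convex H S"
    and same: "\<And>v. v \<in> pverts G \<Longrightarrow> f v \<in> S \<longleftrightarrow> g v \<in> S"
    and x: "x \<in> pverts G" "f x \<notin> S" and a: "a \<in> pverts G" "f a \<in> S" "(a, x) \<in> parcs G"
    and u: "u \<in> pverts G" "f u \<in> S" and v: "v \<in> pverts G" "f v \<in> S" and "u \<noteq> v"
  shows "(u, v) \<in> parcs G"
proof (rule joined_outside_clique[OF S x _ u v \<open>u \<noteq> v\<close>])
  fix w assume w: "w \<in> pverts G" "f w \<in> S"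
  show "(w, x) \<in> parcs G"
    using module[OF S a(2) _ a(1) w(1) x(1) a(3)] same w a x by auto
qed

text \<open>A missing vertex would, by connectedness, give arcs leaving the trace in both
  \<open>G\<close> and \<open>K\<close>; then \<open>u\<close> and \<open>v\<close> would be
  adjacent in both.\<close>

lemma two_copies_imp_all:
  assumes S: "monophonic_convex H S"
    and same: "\<And>v. v \<in> pverts G \<Longrightarrow> f v \<in> S \<longleftrightarrow> g v \<in> S"
    and u: "u \<in> pverts G" "f u \<in> S" and v: "v \<in> pverts G" "f v \<in> S" and "u \<noteq> v"
  shows "S = pverts H"
proof (rule ccontr)
  interpret K: prism K G H g f by (rule swap)
  assume "S \<noteq> pverts H"
  moreover have "S \<subseteq> pverts H" using S by (simp add: monophonic_convex_def)
  ultimately obtain y where y: "y \<in> pverts G" "f y \<notin> S"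
    using same by (auto simp: verts_H)
  obtain a x where ax: "f a \<in> S" "f x \<notin> S" "(a, x) \<in> parcs G"
    using connected_arc_leaving[OF graph_G connected_G, of u "{v. f v \<in> S}" y] u y by auto
  obtain b z where bz: "f b \<in> S" "f z \<notin> S" "(b, z) \<in> parcs K"
    using connected_arc_leaving[OF graph_K connected_K, of u "{v. f v \<in> S}" y] u y
    by (auto simp: verts_K)
  have wf: "pair_wf_digraph G" "pair_wf_digraph K"
    using graph_G graph_K by (auto intro: pair_graph.axioms pair_digraph.axioms
        pair_fin_digraph.axioms)
  have V: "a \<in> pverts G" "x \<in> pverts G" "b \<in> pverts G" "z \<in> pverts G"
    using pair_wf_digraph.wellformed'[OF wf(1)] pair_wf_digraph.wellformed'[OF wf(2)] ax bz
    by (auto simp: verts_K)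
  have "(u, v) \<in> parcs G"
    using outside_adjacent_imp_clique[OF S, of x a u v] same u v ax V \<open>u \<noteq> v\<close> by auto
  moreover have "(u, v) \<in> parcs K"
    using K.outside_adjacent_imp_clique[OF S, of z b u v] same u v bz V \<open>u \<noteq> v\<close>
    by (auto simp: verts_K)
  ultimately show False using arcs_K u v \<open>u \<noteq> v\<close> by auto
qed

section \<open>Classification of the proper convex sets\<close>

lemma one_sided_clique:
  assumes S: "monophonic_convex H S" and "\<And>v. v \<in> pverts G \<Longrightarrow> g v \<notin> S"
  shows "\<exists>A. clique G A \<and> S = f ` A"
proof (intro exI conjI)
  let ?A = "{v \<in> pverts G. f v \<in> S}"
  show "clique G ?A"
    using non_adjacent_imp_copy[OF S] assms(2) by (auto simp: clique_def)
  show "S = f ` ?A"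
    using S assms(2) by (auto simp: monophonic_convex_def verts_H)
qed

lemma two_sided_eq_edge:
  assumes S: "monophonic_convex H S" "S \<noteq> pverts H"
    and a: "a \<in> pverts G" "f a \<in> S" and b: "b \<in> pverts G" "g b \<in> S"
  shows "\<exists>u\<in>pverts G. S = {f u, g u}"
proof -
  have ab: "f b \<in> S" "g a \<in> S"
    using cross[OF S(1) a(2,1) b(2,1)] a b by (cases "a = b"; simp)+
  \<comment> \<open>Pairing \<open>v\<close> with \<open>a\<close> in \<open>cross\<close> moves
    membership from either side to the other.\<close>
  have same: "f v \<in> S \<longleftrightarrow> g v \<in> S" if v: "v \<in> pverts G" for v
  proof (cases "v = a")
    case False
    then show ?thesis
      using cross[OF S(1) a(2,1) _ v] cross[OF S(1) _ v ab(2) a(1)] by blast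
  qed (use a ab in simp)
  have only: "v = a" if "v \<in> pverts G" "f v \<in> S" for v
    using two_copies_imp_all[OF S(1) same that a] S(2) by blast
  have "S \<subseteq> {f a, g a}"
  proof
    fix s assume "s \<in> S"
    then obtain v where v: "v \<in> pverts G" "s = f v \<or> s = g v"
      using S(1) by (auto simp: monophonic_convex_def verts_H)
    with \<open>s \<in> S\<close> have "f v \<in> S" using same[OF v(1)] by blast
    with only v show "s \<in> {f a, g a}" by blast
  qed
  with a ab have "S = {f a, g a}" by blast
  with a show ?thesis by blast
qed

end

section \<open>Application to the complementary prism\<close>

lemma prism_complementary_prism:
  assumes "pair_graph G" "Digraph_Component.connected (with_proj G)"
    "Digraph_Component.connected (with_proj (graph_complement G))"
  shows "prism G (graph_complement G) (complementary_prism G) Inl Inr"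
  by (intro prism.intro)
    (use assms pair_graph_graph_complement in
      \<open>auto simp: complementary_prism_def graph_complement_def Plus_def\<close>)

text \<open>Since \<open>independent\<close> also tests \<open>u = v\<close>, loop-freeness of
  \<open>G\<close> enters here.\<close>

lemma clique_graph_complement_iff:
  assumes "pair_graph G"
  shows "clique (graph_complement G) S \<longleftrightarrow> independent G S"
proof -
  interpret pair_graph G by fact
  show ?thesis
    using pair_no_loops by (fastforce simp: clique_def independent_def graph_complement_def)
qed

lemma clique_complementary_prism_Inl:
  "clique G A \<Longrightarrow> clique (complementary_prism G) (Inl ` A)"
  by (auto simp: clique_def complementary_prism_def)

lemma clique_complementary_prism_Inr:
  "clique (graph_complement G) A \<Longrightarrow> clique (complementary_prism G) (Inr ` A)"
  by (auto simp: clique_def complementary_prism_def graph_complement_def)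

theorem theorem3p1:
  fixes G :: "'a pair_pre_digraph"
  assumes "pair_graph G"
    and "Digraph_Component.connected (with_proj G)"
    and "Digraph_Component.connected (with_proj (graph_complement G))"
  shows "monophonic_convexity_number (complementary_prism G)
           = max (clique_number G) (independence_number G)"
proof -
  let ?H = "complementary_prism G" and ?K = "graph_complement G"
  interpret P: prism G ?K ?H Inl Inr
    by (rule prism_complementary_prism[OF assms])
  interpret K: prism ?K G ?H Inr Inl by (rule P.swap)
  interpret pair_graph G by fact
  have fin: "finite (pverts G)" by simp
  have ne: "pverts G \<noteq> {}"
    using assms(2) by (auto simp: connected_conv)
  \<comment> \<open>Polymorphic, since it serves vertex sets of both \<open>G\<close> and the
    prism.\<close>
  have fin_card: "finite {card S |S :: 'c set. Q S}"
    if "finite V" "\<And>S. Q S \<Longrightarrow> S \<subseteq> V" for Q and V :: "'c set"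
    by (rule finite_subset[of _ "{..card V}"]) (use that in \<open>auto intro: card_mono\<close>)
  have \<omega>: "card A \<le> clique_number G" if "clique G A" for A
    unfolding clique_number_def
    by (rule Max_ge, rule fin_card[OF fin]) (use that in \<open>auto simp: clique_def\<close>)
  have \<alpha>: "card A \<le> independence_number G" if "independent G A" for A
    unfolding independence_number_def
    by (rule Max_ge, rule fin_card[OF fin]) (use that in \<open>auto simp: independent_def\<close>)
  let ?X = "{card S |S. monophonic_convex ?H S \<and> S \<noteq> pverts ?H}"
  have finX: "finite ?X"
    by (rule fin_card[of "pverts ?H"]) (use fin in \<open>auto simp: monophonic_convex_def P.verts_H\<close>)
  have "monophonic_convex ?H {}" "{} \<noteq> pverts ?H"
    using ne by (simp_all add: monophonic_convex_def P.verts_H)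
  then have neX: "?X \<noteq> {}" by blast
  show ?thesis
    unfolding monophonic_convexity_number_def
  proof (rule antisym)
    show "Max ?X \<le> max (clique_number G) (independence_number G)"
    proof (rule Max.boundedI[OF finX neX], clarify)
      fix S assume S: "monophonic_convex ?H S" "S \<noteq> pverts ?H"
      consider "\<forall>v\<in>pverts G. Inr v \<notin> S" | "\<forall>v\<in>pverts G. Inl v \<notin> S"
        | a b where "a \<in> pverts G" "Inl a \<in> S" "b \<in> pverts G" "Inr b \<in> S"
        by blast
      then show "card S \<le> max (clique_number G) (independence_number G)"
      proof cases
        case 1
        then obtain A where "clique G A" "S = Inl ` A"
          using P.one_sided_clique[OF S(1)] by auto
        then show ?thesis using \<omega>[of A] by (simp add: card_image)
      next
        case 2
        then obtain A where "clique ?K A" "S = Inr ` A"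
          using K.one_sided_clique[OF S(1)] by (auto simp: P.verts_K)
        then show ?thesis
          using \<alpha>[of A] clique_graph_complement_iff[OF assms(1)] by (simp add: card_image)
      next
        case 3
        then obtain u where u: "u \<in> pverts G" "S = {Inl u, Inr u}"
          using P.two_sided_eq_edge[OF S] by blast
        \<comment> \<open>The matching edge has two elements. As \<open>S\<close> is proper,
          \<open>G\<close> has a second vertex and, being connected, an edge, so its clique number
          is at least 2.\<close>
        with S(2) obtain y where y: "y \<in> pverts G" "y \<noteq> u"
          by (auto simp: P.verts_H)
        obtain v x where vx: "v = u" "x \<noteq> u" "(v, x) \<in> parcs G"
          using connected_arc_leaving[OF assms(1,2), of u "{u}" y] u y by auto
        then have "clique G {u, x}"
          using P.G_sym[of u x] wellformed'[of u x] by (auto simp: clique_def)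
        from \<omega>[OF this] vx u show ?thesis by simp
      qed
    qed
    \<comment> \<open>Lower bound for both numbers at once: \<open>h\<close> will be
      \<open>Inl\<close> or \<open>Inr\<close>, and the image is proper because the other side is
      non-empty.\<close>
    have L: "card A \<le> Max ?X" if "clique ?H (h ` A)" "inj h" "h ` A \<noteq> pverts ?H"
      for A and h :: "'a \<Rightarrow> 'a + 'a"
    proof -
      have "card (h ` A) \<in> ?X"
        using clique_monophonic_convex[OF that(1)] that(3)
        by (intro CollectI exI[of _ "h ` A"] conjI refl)
      moreover have "card (h ` A) = card A"
        using card_image[OF inj_on_subset[OF that(2) subset_UNIV]] .
      ultimately show ?thesis using Max_ge[OF finX, of "card (h ` A)"] by simp
    qed
    have "card A \<le> Max ?X" if "clique G A" for A
      by (rule L[of Inl]) (use that ne clique_complementary_prism_Inl in \<open>auto simp: P.verts_H\<close>)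
    moreover have "clique G {}" by (simp add: clique_def)
    moreover have "finite {card A |A. clique G A}"
      by (rule fin_card[OF fin]) (simp add: clique_def)
    ultimately have "clique_number G \<le> Max ?X"
      unfolding clique_number_def by (subst Max_le_iff) auto
    moreover have "card A \<le> Max ?X" if "independent G A" for A
      by (rule L[of Inr]) (use that ne clique_complementary_prism_Inr
          clique_graph_complement_iff[OF assms(1)] in \<open>auto simp: P.verts_H\<close>)
    moreover have "independent G {}" by (simp add: independent_def)
    moreover have "finite {card A |A. independent G A}"
      by (rule fin_card[OF fin]) (simp add: independent_def)
    ultimately have "independence_number G \<le> Max ?X"
      unfolding independence_number_def by (subst Max_le_iff) auto
    with \<open>clique_number G \<le> Max ?X\<close>
    show "max (clique_number G) (independence_number G) \<le> Max ?X" by simp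
  qed
qed

end
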